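(* Let $n$ be a positive integer and let $A,B\in\mathcal{B}_n$. If $A\sim A^S$ and $B\sim A$, then $B\sim B^S$.
   Context: $\mathcal{B}_n$ is the set of all $n\times n$ matrices with entries in $\{0,1\}$. $A\sim B$ means that one matrix is obtained from the other by a finite (possibly empty) sequence of moves, each move taking the first row to the last place or the first column to the last place (the other rows, respectively columns, being shifted cyclically). For $A=(a_{ij})\in\mathcal{B}_n$, the mirror image is $A^S=(a_{i,\,n-j+1})$, $1\le i,j\le n$, i.e. the columns of $A$ in reverse order. *)

theory Defs
  imports "Jordan_Normal_Form.Matrix"
begin

definition binary_mats :: "nat \<Rightarrow> nat mat set" where
  "binary_mats n = {A \<in> carrier_mat n n. elements_mat A \<subseteq> {0, 1}}"

definition rotate_rows :: "'a mat \<Rightarrow> 'a mat" where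
  "rotate_rows A =
    mat (dim_row A) (dim_col A) (\<lambda>(i, j). A $$ (Suc i mod dim_row A, j))"

definition rotate_cols :: "'a mat \<Rightarrow> 'a mat" where
  "rotate_cols A =
    mat (dim_row A) (dim_col A) (\<lambda>(i, j). A $$ (i, Suc j mod dim_col A))"

inductive move :: "'a mat \<Rightarrow> 'a mat \<Rightarrow> bool" where
  rows: "move A (rotate_rows A)"
| cols: "move A (rotate_cols A)"

text \<open>
  The disjunction renders ``one matrix is obtained from the other''; symmetry of
  the relation is thus built in, whereas its transitivity is not.
\<close>

definition shift_equiv :: "'a mat \<Rightarrow> 'a mat \<Rightarrow> bool" (infix "\<sim>" 50) where
  "A \<sim> B \<longleftrightarrow> move\<^sup>*\<^sup>* A B \<or> move\<^sup>*\<^sup>* B A"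

text \<open>
  Matrix indices start at 0, so the 1-based column n - j + 1 becomes n - 1 - j.
\<close>

definition mirror :: "'a mat \<Rightarrow> 'a mat" where
  "mirror A =
    mat (dim_row A) (dim_col A) (\<lambda>(i, j). A $$ (i, dim_col A - 1 - j))"

end

theory Submission
  imports Defs
begin

text \<open>
  Every move is a cyclic shift of finite order, so it is undone by repeating it: reachability by
  moves is an equivalence relation (\<open>move_rtranclp_sym\<close>), and the two directions in the
  definition of \<open>\<sim>\<close> coincide (\<open>shift_equiv_iff_move_rtranclp\<close>).

  The mirror image respects this relation, because it commutes with the row shift and conjugates
  the column shift into its inverse; hence \<open>A \<sim> B\<close> implies \<open>mirror A \<sim> mirror B\<close>
  (\<open>mirror_move_rtranclp\<close>).  The theorem is then the chain
  \<open>B \<sim> A \<sim> mirror A \<sim> mirror B\<close>.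
\<close>

lemma dim_rotate_rows [simp]:
  "dim_row (rotate_rows A) = dim_row A" "dim_col (rotate_rows A) = dim_col A"
  by (simp_all add: rotate_rows_def)

lemma dim_rotate_cols [simp]:
  "dim_row (rotate_cols A) = dim_row A" "dim_col (rotate_cols A) = dim_col A"
  by (simp_all add: rotate_cols_def)

lemma dim_mirror [simp]:
  "dim_row (mirror A) = dim_row A" "dim_col (mirror A) = dim_col A"
  by (simp_all add: mirror_def)

lemma index_rotate_rows [simp]:
  "i < dim_row A \<Longrightarrow> j < dim_col A \<Longrightarrow> rotate_rows A $$ (i, j) = A $$ (Suc i mod dim_row A, j)"
  by (simp add: rotate_rows_def)

lemma index_rotate_cols [simp]:
  "i < dim_row A \<Longrightarrow> j < dim_col A \<Longrightarrow> rotate_cols A $$ (i, j) = A $$ (i, Suc j mod dim_col A)"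
  by (simp add: rotate_cols_def)

lemma index_mirror [simp]:
  "i < dim_row A \<Longrightarrow> j < dim_col A \<Longrightarrow> mirror A $$ (i, j) = A $$ (i, dim_col A - 1 - j)"
  by (simp add: mirror_def)

lemma dim_funpow_rotate_rows [simp]:
  "dim_row ((rotate_rows ^^ k) A) = dim_row A" "dim_col ((rotate_rows ^^ k) A) = dim_col A"
  by (induction k) simp_all

lemma dim_funpow_rotate_cols [simp]:
  "dim_row ((rotate_cols ^^ k) A) = dim_row A" "dim_col ((rotate_cols ^^ k) A) = dim_col A"
  by (induction k) simp_all

lemma index_funpow_rotate_rows:
  assumes "i < dim_row A" "j < dim_col A"
  shows "(rotate_rows ^^ k) A $$ (i, j) = A $$ ((i + k) mod dim_row A, j)"
  using assms
proof (induction k arbitrary: i)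
  case (Suc k)
  then have "Suc i mod dim_row A < dim_row A"
    by (intro mod_less_divisor) simp
  then show ?case
    using Suc by (simp add: mod_simps)
qed simp

lemma index_funpow_rotate_cols:
  assumes "i < dim_row A" "j < dim_col A"
  shows "(rotate_cols ^^ k) A $$ (i, j) = A $$ (i, (j + k) mod dim_col A)"
  using assms
proof (induction k arbitrary: j)
  case (Suc k)
  then have "Suc j mod dim_col A < dim_col A"
    by (intro mod_less_divisor) simp
  then show ?case
    using Suc by (simp add: mod_simps)
qed simp

lemma funpow_rotate_rows_dim_row: "(rotate_rows ^^ dim_row A) A = A"
  by (rule eq_matI) (simp_all add: index_funpow_rotate_rows)

lemma funpow_rotate_cols_dim_col: "(rotate_cols ^^ dim_col A) A = A"
  by (rule eq_matI) (simp_all add: index_funpow_rotate_cols)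

lemma rtranclp_funpow:
  assumes "\<And>x. r x (f x)"
  shows "r\<^sup>*\<^sup>* x ((f ^^ k) x)"
  proof (induction k)
  case (Suc k)
  with assms[of "(f ^^ k) x"] show ?case
    by (simp add: rtranclp.rtrancl_into_rtrancl)
qed simp

text \<open>
  The shift has order dividing the number of rows (or columns), so that one fewer repetition
  inverts it.  Without rows (or columns) there is no such smaller number, but then the shift is
  the identity.
\<close>

lemma move_reversible:
  assumes "move A B"
  shows "move\<^sup>*\<^sup>* B A"
  using assms
proof cases
  case rows
  show ?thesis
  proof (cases "dim_row A")
    case 0
    then have "rotate_rows A = A"
      by (intro eq_matI) simp_all
    with rows show ?thesis
      by simp
  next
    case (Suc k)
    then have "(rotate_rows ^^ k) (rotate_rows A) = A"
      using funpow_rotate_rows_dim_row[of A] by (simp add: funpow_swap1)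
    with rows show ?thesis
      using rtranclp_funpow[of move rotate_rows "rotate_rows A" k] by (simp add: move.rows)
  qed
next
  case cols
  show ?thesis
  proof (cases "dim_col A")
    case 0
    then have "rotate_cols A = A"
      by (intro eq_matI) simp_all
    with cols show ?thesis
      by simp
  next
    case (Suc k)
    then have "(rotate_cols ^^ k) (rotate_cols A) = A"
      using funpow_rotate_cols_dim_col[of A] by (simp add: funpow_swap1)
    with cols show ?thesis
      using rtranclp_funpow[of move rotate_cols "rotate_cols A" k] by (simp add: move.cols)
  qed
qed

lemma move_rtranclp_sym:
  assumes "move\<^sup>*\<^sup>* A B"
  shows "move\<^sup>*\<^sup>* B A"
  using assms
proof induction
  case (step B C)
  with move_reversible show ?case
    by (metis rtranclp_trans)
qed simp

lemma shift_equiv_iff_move_rtranclp: "A \<sim> B \<longleftrightarrow> move\<^sup>*\<^sup>* A B"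
  unfolding shift_equiv_def by (blast intro: move_rtranclp_sym)

lemma mirror_rotate_rows: "mirror (rotate_rows A) = rotate_rows (mirror A)"
proof (rule eq_matI)
  fix i j
  assume "i < dim_row (rotate_rows (mirror A))" "j < dim_col (rotate_rows (mirror A))"
  moreover from this have "Suc i mod dim_row A < dim_row A"
    by (intro mod_less_divisor) simp
  ultimately show "mirror (rotate_rows A) $$ (i, j) = rotate_rows (mirror A) $$ (i, j)"
    by simp
qed simp_all

text \<open>
  Reversing the column order turns a shift to the left into a shift to the right, which a further
  shift to the left cancels.
\<close>

lemma rotate_cols_mirror_rotate_cols: "rotate_cols (mirror (rotate_cols A)) = mirror A"
proof (rule eq_matI)
  fix i j
  assume "i < dim_row (mirror A)" "j < dim_col (mirror A)"
  then have ij: "i < dim_row A" "j < dim_col A"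
    by simp_all
  then have "Suc j mod dim_col A < dim_col A"
    by (intro mod_less_divisor) simp
  moreover have "Suc (dim_col A - 1 - Suc j mod dim_col A) mod dim_col A = dim_col A - 1 - j"
  proof (cases "Suc j = dim_col A")
    case True
    then show ?thesis
      by (simp flip: True)
  next
    case False
    with ij have "Suc j < dim_col A"
      by simp
    then show ?thesis
      by (simp add: Suc_diff_Suc)
  qed
  ultimately show "rotate_cols (mirror (rotate_cols A)) $$ (i, j) = mirror A $$ (i, j)"
    using ij by simp
qed simp_all

lemma mirror_move:
  assumes "move A B"
  shows "move\<^sup>*\<^sup>* (mirror A) (mirror B)"
  using assms
proof cases
  case rows
  then show ?thesis
    by (simp add: mirror_rotate_rows move.rows r_into_rtranclp)
next
  case cols
  then have "move (mirror B) (mirror A)"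
    using move.cols[of "mirror B"] by (simp add: rotate_cols_mirror_rotate_cols)
  then show ?thesis
    by (rule move_reversible)
qed

lemma mirror_move_rtranclp:
  assumes "move\<^sup>*\<^sup>* A B"
  shows "move\<^sup>*\<^sup>* (mirror A) (mirror B)"
  using assms
proof induction
  case (step B C)
  with mirror_move show ?case
    by (metis rtranclp_trans)
qed simp

theorem theorem1:
  fixes n :: nat and A B :: "nat mat"
  assumes "n > 0"
    and "A \<in> binary_mats n" and "B \<in> binary_mats n"
    and "A \<sim> mirror A"
    and "B \<sim> A"
  shows "B \<sim> mirror B"
proof -
  have BA: "move\<^sup>*\<^sup>* B A"
    using assms(5) by (simp add: shift_equiv_iff_move_rtranclp)
  also have "move\<^sup>*\<^sup>* A (mirror A)"
    using assms(4) by (simp add: shift_equiv_iff_move_rtranclp)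
  also have "move\<^sup>*\<^sup>* (mirror A) (mirror B)"
    by (rule mirror_move_rtranclp[OF move_rtranclp_sym[OF BA]])
  finally show ?thesis
    by (simp add: shift_equiv_iff_move_rtranclp)
qed

end
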